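(* Let $\lambda\neq0$ be a real number. Every vector field $X=f_1e_1+f_2e_2+f_3e_3$ on $(H_3,g_2)$ with $$f_1=-\tfrac{c_1}{\lambda}x+c_2,\qquad f_2=c_1y+c_3,\qquad f_3=-\tfrac{c_1}{2\lambda}x^2-\tfrac{\lambda c_1}{2}y^2+c_2x-\lambda c_3y+c_4,$$ where $c_1,c_2,c_3,c_4\in\mathbb{R}$, is a Killing vector field of $(H_3,g_2)$. Moreover, a smooth vector field on $(H_3,g_2)$ is a Ricci collineation if and only if it is a curvature collineation.
   Context: The Heisenberg group $H_3$ is $\mathbb{R}^3$ with global coordinates $(x,y,z)$ and multiplication $(x,y,z)(\tilde x,\tilde y,\tilde z)=(x+\tilde x,y+\tilde y,z+\tilde z-x\tilde y)$. For $\lambda\neq0$, $g_2$ is the left-invariant Lorentzian metric $g_2=\frac{1}{\lambda^2}dx^2+dy^2-(x\,dy+dz)^2$, with left-invariant orthonormal frame $e_1=\partial_y-x\partial_z$, $e_2=\lambda\partial_x$, $e_3=\partial_z$ ($e_3$ timelike). The curvature tensor is the $(1,3)$-tensor $R(X,Y)=[\nabla_X,\nabla_Y]-\nabla_{[X,Y]}$ of the Levi-Civita connection $\nabla$, and the Ricci tensor is $\varrho(X,Y)=\sum_k g(e_k,e_k)\,g(R(e_k,X)Y,e_k)$ for an orthonormal basis $\{e_k\}$. A smooth vector field $X$ is Killing if $\mathcal{L}_Xg=0$, a Ricci collineation if $\mathcal{L}_X\varrho=0$, and a curvature collineation if $\mathcal{L}_XR=0$. *)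

theory Defs
  imports "HOL-Analysis.Analysis"
begin

section \<open>Smooth vector fields on a Euclidean space\<close>

text \<open>All manifolds are a whole Euclidean space with one global chart, so a vector field is the
  function of its components in the coordinate frame.\<close>

type_synonym 'a vector_field = "'a \<Rightarrow> 'a"

fun C_k :: "nat \<Rightarrow> ('a::euclidean_space \<Rightarrow> 'b::real_normed_vector) \<Rightarrow> bool" where
  "C_k 0 f \<longleftrightarrow> continuous_on UNIV f"
| "C_k (Suc n) f \<longleftrightarrow>
     (\<forall>p. f differentiable (at p)) \<and> (\<forall>v. C_k n (\<lambda>p. frechet_derivative f (at p) v))"

definition smooth :: "('a::euclidean_space \<Rightarrow> 'b::real_normed_vector) \<Rightarrow> bool" where
  "smooth f \<longleftrightarrow> (\<forall>n. C_k n f)"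

definition dir_deriv ::
    "'a::euclidean_space vector_field \<Rightarrow> ('a \<Rightarrow> 'b::real_normed_vector) \<Rightarrow> 'a \<Rightarrow> 'b" where
  "dir_deriv X f = (\<lambda>p. frechet_derivative f (at p) (X p))"

definition lie_bracket ::
    "'a::euclidean_space vector_field \<Rightarrow> 'a vector_field \<Rightarrow> 'a vector_field" where
  "lie_bracket X Y = (\<lambda>p. dir_deriv X Y p - dir_deriv Y X p)"

section \<open>Levi-Civita connection and curvature\<close>

text \<open>A metric \<open>g\<close> assigns to a point \<open>p\<close> a bilinear form \<open>g p\<close> on the tangent space at \<open>p\<close>.\<close>

type_synonym 'a metric_field = "'a \<Rightarrow> 'a \<Rightarrow> 'a \<Rightarrow> real"

definition metric_apply ::
    "'a metric_field \<Rightarrow> 'a vector_field \<Rightarrow> 'a vector_field \<Rightarrow> 'a \<Rightarrow> real" where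
  "metric_apply g Y Z = (\<lambda>p. g p (Y p) (Z p))"

definition affine_connection ::
    "('a::euclidean_space vector_field \<Rightarrow> 'a vector_field \<Rightarrow> 'a vector_field) \<Rightarrow> bool" where
  "affine_connection D \<longleftrightarrow>
     (\<forall>X Y. smooth X \<longrightarrow> smooth Y \<longrightarrow> smooth (D X Y)) \<and>
     (\<forall>X X' Y. smooth X \<longrightarrow> smooth X' \<longrightarrow> smooth Y \<longrightarrow>
        D (\<lambda>p. X p + X' p) Y = (\<lambda>p. D X Y p + D X' Y p)) \<and>
     (\<forall>f X Y. smooth f \<longrightarrow> smooth X \<longrightarrow> smooth Y \<longrightarrow>
        D (\<lambda>p. f p *\<^sub>R X p) Y = (\<lambda>p. f p *\<^sub>R D X Y p)) \<and>
     (\<forall>X Y Y'. smooth X \<longrightarrow> smooth Y \<longrightarrow> smooth Y' \<longrightarrow>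
        D X (\<lambda>p. Y p + Y' p) = (\<lambda>p. D X Y p + D X Y' p)) \<and>
     (\<forall>f X Y. smooth f \<longrightarrow> smooth X \<longrightarrow> smooth Y \<longrightarrow>
        D X (\<lambda>p. f p *\<^sub>R Y p) = (\<lambda>p. f p *\<^sub>R D X Y p + dir_deriv X f p *\<^sub>R Y p))"

definition is_levi_civita ::
    "'a::euclidean_space metric_field \<Rightarrow>
     ('a vector_field \<Rightarrow> 'a vector_field \<Rightarrow> 'a vector_field) \<Rightarrow> bool" where
  "is_levi_civita g D \<longleftrightarrow>
     affine_connection D \<and>
     (\<forall>X Y. smooth X \<longrightarrow> smooth Y \<longrightarrow> (\<lambda>p. D X Y p - D Y X p) = lie_bracket X Y) \<and>
     (\<forall>X Y Z. smooth X \<longrightarrow> smooth Y \<longrightarrow> smooth Z \<longrightarrow>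
        dir_deriv X (metric_apply g Y Z) =
        (\<lambda>p. metric_apply g (D X Y) Z p + metric_apply g Y (D X Z) p))"

text \<open>For a smooth nondegenerate metric the connection is unique on smooth vector fields; on other
  arguments the chosen operator is arbitrary, which is why this is not written with \<open>THE\<close>.\<close>

definition levi_civita ::
    "'a::euclidean_space metric_field \<Rightarrow>
     'a vector_field \<Rightarrow> 'a vector_field \<Rightarrow> 'a vector_field" where
  "levi_civita g = (SOME D. is_levi_civita g D)"

definition curvature ::
    "'a::euclidean_space metric_field \<Rightarrow>
     'a vector_field \<Rightarrow> 'a vector_field \<Rightarrow> 'a vector_field \<Rightarrow> 'a vector_field" where
  "curvature g X Y Z =
     (let D = levi_civita g in
      (\<lambda>p. D X (D Y Z) p - D Y (D X Z) p - D (lie_bracket X Y) Z p))"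

definition orthonormal_frame ::
    "'a::euclidean_space metric_field \<Rightarrow> ('i::finite \<Rightarrow> 'a vector_field) \<Rightarrow> bool" where
  "orthonormal_frame g E \<longleftrightarrow>
     CARD('i) = DIM('a) \<and>
     (\<forall>p i j. i \<noteq> j \<longrightarrow> g p (E i p) (E j p) = 0) \<and>
     (\<forall>p i. \<bar>g p (E i p) (E i p)\<bar> = 1)"

text \<open>The Ricci tensor, computed in an orthonormal frame \<open>E\<close> of \<open>g\<close>.\<close>

definition ricci ::
    "'a::euclidean_space metric_field \<Rightarrow> ('i::finite \<Rightarrow> 'a vector_field) \<Rightarrow>
     'a vector_field \<Rightarrow> 'a vector_field \<Rightarrow> 'a \<Rightarrow> real" where
  "ricci g E X Y =
     (\<lambda>p. \<Sum>k\<in>UNIV. metric_apply g (E k) (E k) p * metric_apply g (curvature g (E k) X Y) (E k) p)"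

section \<open>Lie derivatives and symmetries\<close>

definition lie_deriv_02 ::
    "'a::euclidean_space vector_field \<Rightarrow> ('a vector_field \<Rightarrow> 'a vector_field \<Rightarrow> 'a \<Rightarrow> real) \<Rightarrow>
     'a vector_field \<Rightarrow> 'a vector_field \<Rightarrow> 'a \<Rightarrow> real" where
  "lie_deriv_02 X T Y Z =
     (\<lambda>p. dir_deriv X (T Y Z) p - T (lie_bracket X Y) Z p - T Y (lie_bracket X Z) p)"

definition lie_deriv_13 ::
    "'a::euclidean_space vector_field \<Rightarrow>
     ('a vector_field \<Rightarrow> 'a vector_field \<Rightarrow> 'a vector_field \<Rightarrow> 'a vector_field) \<Rightarrow>
     'a vector_field \<Rightarrow> 'a vector_field \<Rightarrow> 'a vector_field \<Rightarrow> 'a vector_field" where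
  "lie_deriv_13 X T Y Z W =
     (\<lambda>p. lie_bracket X (T Y Z W) p - T (lie_bracket X Y) Z W p
          - T Y (lie_bracket X Z) W p - T Y Z (lie_bracket X W) p)"

definition killing_field ::
    "'a::euclidean_space metric_field \<Rightarrow> 'a vector_field \<Rightarrow> bool" where
  "killing_field g X \<longleftrightarrow>
     smooth X \<and>
     (\<forall>Y Z. smooth Y \<longrightarrow> smooth Z \<longrightarrow> lie_deriv_02 X (metric_apply g) Y Z = (\<lambda>p. 0))"

definition ricci_collineation ::
    "'a::euclidean_space metric_field \<Rightarrow> ('i::finite \<Rightarrow> 'a vector_field) \<Rightarrow>
     'a vector_field \<Rightarrow> bool" where
  "ricci_collineation g E X \<longleftrightarrow>
     smooth X \<and>
     (\<forall>Y Z. smooth Y \<longrightarrow> smooth Z \<longrightarrow> lie_deriv_02 X (ricci g E) Y Z = (\<lambda>p. 0))"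

definition curvature_collineation ::
    "'a::euclidean_space metric_field \<Rightarrow> 'a vector_field \<Rightarrow> bool" where
  "curvature_collineation g X \<longleftrightarrow>
     smooth X \<and>
     (\<forall>Y Z W. smooth Y \<longrightarrow> smooth Z \<longrightarrow> smooth W \<longrightarrow>
        lie_deriv_13 X (curvature g) Y Z W = (\<lambda>p. 0))"

section \<open>The Heisenberg group with the metric \<open>g\<^sub>2\<close>\<close>

text \<open>The coordinates \<open>(x, y, z)\<close> of a point \<open>p\<close> are \<open>p $ 1\<close>, \<open>p $ 2\<close>, \<open>p $ 3\<close>.\<close>

type_synonym heis = "real ^ 3"

definition heis_mult :: "heis \<Rightarrow> heis \<Rightarrow> heis" where
  "heis_mult a b = vector [a $ 1 + b $ 1, a $ 2 + b $ 2, a $ 3 + b $ 3 - a $ 1 * b $ 2]"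

definition g2 :: "real \<Rightarrow> heis metric_field" where
  "g2 lam p u v =
     (1 / lam\<^sup>2) * (u $ 1 * v $ 1) + u $ 2 * v $ 2
     - (p $ 1 * u $ 2 + u $ 3) * (p $ 1 * v $ 2 + v $ 3)"

definition e1 :: "heis vector_field" where
  "e1 p = vector [0, 1, - (p $ 1)]"

definition e2 :: "real \<Rightarrow> heis vector_field" where
  "e2 lam p = vector [lam, 0, 0]"

definition e3 :: "heis vector_field" where
  "e3 p = vector [0, 0, 1]"

definition heis_frame :: "real \<Rightarrow> 3 \<Rightarrow> heis vector_field" where
  "heis_frame lam k = (if k = 1 then e1 else if k = 2 then e2 lam else e3)"

subsection \<open>The frame is orthonormal, and frame and metric are left-invariant\<close>

lemma heis_frame_orthonormal:
  assumes "lam \<noteq> 0"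
  shows "orthonormal_frame (g2 lam) (heis_frame lam)"
  using assms
  by (auto simp: orthonormal_frame_def forall_3 heis_frame_def g2_def e1_def e2_def e3_def
      power2_eq_square)

lemma g2_e3_timelike: "g2 lam p (e3 p) (e3 p) = - 1"
  by (simp add: g2_def e3_def)

lemma heis_left_translation_derivative:
  "(heis_mult a has_derivative (\<lambda>u. vector [u $ 1, u $ 2, u $ 3 - a $ 1 * u $ 2])) (at p)"
proof -
  have nth: "((\<lambda>q::heis. q $ i) has_derivative (\<lambda>u. u $ i)) (at p)" for i
    by (rule bounded_linear.has_derivative[OF bounded_linear_vec_nth has_derivative_ident])
  have vec: "vector [x, y, z] = axis 1 x + axis 2 y + (axis 3 z :: heis)" for x y z
    by (simp add: vec_eq_iff forall_3 axis_def)
  have ax: "((\<lambda>q. axis i (f q) :: heis) has_derivative (\<lambda>u. axis i (f' u))) (at p)"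
    if "(f has_derivative f') (at p)" for i f f'
  proof -
    have eq: "x *\<^sub>R (axis i 1 :: heis) = axis i x" for x :: real
      by (simp add: vec_eq_iff axis_def)
    show ?thesis
      using has_derivative_scaleR_left[OF that, of "axis i 1 :: heis"] unfolding eq .
  qed
  show ?thesis
    unfolding heis_mult_def[abs_def] vec
    by (intro has_derivative_add ax; auto intro!: derivative_eq_intros nth)
qed

lemma g2_left_invariant:
  "g2 lam (heis_mult a p) (frechet_derivative (heis_mult a) (at p) u)
     (frechet_derivative (heis_mult a) (at p) v) = g2 lam p u v"
  unfolding frechet_derivative_at[OF heis_left_translation_derivative, symmetric]
  by (simp add: g2_def heis_mult_def algebra_simps)

lemma heis_frame_left_invariant:
  "frechet_derivative (heis_mult a) (at p) (heis_frame lam k p) = heis_frame lam k (heis_mult a p)"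
  unfolding frechet_derivative_at[OF heis_left_translation_derivative, symmetric]
  by (simp add: vec_eq_iff forall_3 heis_frame_def e1_def e2_def e3_def heis_mult_def)

end

theory Submission
  imports Defs
begin

text \<open>In the frame \<open>e\<^sub>1, e\<^sub>2, e\<^sub>3\<close>, whose only nonzero bracket is \<open>[e\<^sub>1, e\<^sub>2] = \<lambda> e\<^sub>3\<close>, the Ricci tensor
  of \<open>g\<^sub>2\<close> is \<open>\<lambda>\<^sup>2/2\<close> times the identity matrix, so a Ricci collineation
  \<open>f\<^sub>1 e\<^sub>1 + f\<^sub>2 e\<^sub>2 + f\<^sub>3 e\<^sub>3\<close> is a Killing field of the Riemannian metric for which the same frame
  is orthonormal. Differentiating those Killing equations once more gives
  \<open>e\<^sub>3 f\<^sub>1 = e\<^sub>3 f\<^sub>2 = 0\<close>, and then they coincide with the Killing equations of \<open>g\<^sub>2\<close>. The field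
  therefore commutes with \<open>e\<^sub>3\<close> and rotates the plane of \<open>e\<^sub>1, e\<^sub>2\<close>, which leaves the curvature
  tensor invariant. Conversely, the Ricci tensor is a trace of the curvature tensor and the Lie
  derivative commutes with this trace.\<close>

subsection \<open>Calculus of smooth maps\<close>

text \<open>Lets the product rule keep its undifferentiated factor at the lower order. In the base
  case, differentiability gives continuity.\<close>

lemma C_k_Suc_imp_C_k: "C_k (Suc n) f \<Longrightarrow> C_k n f"
proof (induction n arbitrary: f)
  case 0
  then show ?case
    by (auto simp: continuous_on_eq_continuous_at intro: differentiable_imp_continuous_within)
next
  case (Suc n)
  have "C_k n (\<lambda>p. frechet_derivative f (at p) v)" for v
    by (rule Suc.IH) (use Suc.prems C_k.simps(2)[of "Suc n" f] in blast)
  with Suc.prems C_k.simps(2)[of "Suc n" f] show ?case by (simp only: C_k.simps(2)) blast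
qed

lemma C_k_const: "C_k n (\<lambda>p. c)"
  by (induction n arbitrary: c) auto

lemma C_k_id: "C_k n (\<lambda>p. p)"
  by (cases n) (auto simp: C_k_const)

lemma frechet_derivative_add:
  assumes "f differentiable at p" "g differentiable at p"
  shows "frechet_derivative (\<lambda>q. f q + g q) (at p) v
    = frechet_derivative f (at p) v + frechet_derivative g (at p) v"
proof -
  have "((\<lambda>q. f q + g q) has_derivative
      (\<lambda>v. frechet_derivative f (at p) v + frechet_derivative g (at p) v)) (at p)"
    using assms by (intro has_derivative_add) (auto simp: frechet_derivative_works[symmetric])
  from frechet_derivative_at[OF this, symmetric] show ?thesis by simp
qed

lemma frechet_derivative_bounded_linear:
  assumes "bounded_linear h" "f differentiable at p"
  shows "frechet_derivative (\<lambda>q. h (f q)) (at p) v = h (frechet_derivative f (at p) v)"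
proof -
  have "((\<lambda>q. h (f q)) has_derivative (\<lambda>v. h (frechet_derivative f (at p) v))) (at p)"
    by (rule bounded_linear.has_derivative[OF assms(1)])
      (use assms in \<open>simp add: frechet_derivative_works[symmetric]\<close>)
  from frechet_derivative_at[OF this, symmetric] show ?thesis by simp
qed

lemma has_derivative_bilinear_frechet:
  assumes "bounded_bilinear B" "f differentiable at p" "g differentiable at p"
  shows "((\<lambda>q. B (f q) (g q)) has_derivative
     (\<lambda>v. B (f p) (frechet_derivative g (at p) v) + B (frechet_derivative f (at p) v) (g p))) (at p)"
  by (rule bounded_bilinear.FDERIV[OF assms(1)])
    (use assms in \<open>simp_all add: frechet_derivative_works[symmetric]\<close>)

lemma frechet_derivative_bilinear:
  assumes "bounded_bilinear B" "f differentiable at p" "g differentiable at p"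
  shows "frechet_derivative (\<lambda>q. B (f q) (g q)) (at p) v
    = B (f p) (frechet_derivative g (at p) v) + B (frechet_derivative f (at p) v) (g p)"
  using frechet_derivative_at[OF has_derivative_bilinear_frechet[OF assms], symmetric] by simp

lemma C_k_add: "C_k n f \<Longrightarrow> C_k n g \<Longrightarrow> C_k n (\<lambda>p. f p + g p)"
  by (induction n arbitrary: f g) (auto simp: frechet_derivative_add intro: continuous_on_add)

lemma C_k_bounded_linear:
  assumes "bounded_linear h"
  shows "C_k n f \<Longrightarrow> C_k n (\<lambda>p. h (f p))"
proof (induction n arbitrary: f)
  case 0
  then show ?case using bounded_linear.continuous_on[OF assms] by auto
next
  case (Suc n)
  have "(\<lambda>q. h (f q)) differentiable at p" for p
    by (rule differentiableI[OF bounded_linear.has_derivative[OF assms]])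
      (use Suc.prems frechet_derivative_works in auto)
  with Suc show ?case by (auto simp: frechet_derivative_bounded_linear[OF assms])
qed

text \<open>The derivative of a product is a sum of two products of the same shape, so the induction
  runs over all pairs of factors at once. Scaling of fields and products of functions are both
  instances.\<close>

lemma C_k_bilinear:
  assumes B: "bounded_bilinear B"
  shows "C_k n f \<Longrightarrow> C_k n g \<Longrightarrow> C_k n (\<lambda>p. B (f p) (g p))"
proof (induction n arbitrary: f g)
  case 0
  then show ?case using bounded_bilinear.continuous_on[OF B] by auto
next
  case (Suc n)
  have "(\<lambda>q. B (f q) (g q)) differentiable at p" for p
    by (rule differentiableI[OF has_derivative_bilinear_frechet[OF B]]) (use Suc.prems in auto)
  moreover have "C_k n (\<lambda>p. B (f p) (frechet_derivative g (at p) v))" for v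
    by (rule Suc.IH) (use Suc.prems C_k_Suc_imp_C_k in auto)
  moreover have "C_k n (\<lambda>p. B (frechet_derivative f (at p) v) (g p))" for v
    by (rule Suc.IH) (use Suc.prems C_k_Suc_imp_C_k in auto)
  ultimately show ?case
    using Suc.prems by (auto simp: frechet_derivative_bilinear[OF B] intro: C_k_add)
qed

section \<open>Closure properties of smooth maps\<close>

named_theorems smooth_intros

lemma smooth_const [smooth_intros]: "smooth (\<lambda>p. c)"
  and smooth_ident: "smooth (\<lambda>p. p)"
  by (auto simp: smooth_def C_k_const C_k_id)

lemma smooth_add [smooth_intros]: "smooth f \<Longrightarrow> smooth g \<Longrightarrow> smooth (\<lambda>p. f p + g p)"
  by (auto simp: smooth_def C_k_add)

lemma smooth_bounded_linear: "bounded_linear h \<Longrightarrow> smooth f \<Longrightarrow> smooth (\<lambda>p. h (f p))"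
  by (auto simp: smooth_def C_k_bounded_linear)

lemma smooth_minus [smooth_intros]: "smooth f \<Longrightarrow> smooth (\<lambda>p. - f p)"
  by (rule smooth_bounded_linear[OF bounded_linear_minus[OF bounded_linear_ident]])

lemma smooth_diff [smooth_intros]: "smooth f \<Longrightarrow> smooth g \<Longrightarrow> smooth (\<lambda>p. f p - g p)"
  using smooth_add[OF _ smooth_minus, of f g] by simp

lemma smooth_vec_nth [smooth_intros]: "smooth f \<Longrightarrow> smooth (\<lambda>p. f p $ i)"
  by (rule smooth_bounded_linear[OF bounded_linear_vec_nth])

lemma smooth_coordinate [smooth_intros]: "smooth (\<lambda>p. p $ i)"
  by (rule smooth_vec_nth[OF smooth_ident])

lemma smooth_divide_const [smooth_intros]: "smooth f \<Longrightarrow> smooth (\<lambda>p. f p / (c::real))"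
  by (rule smooth_bounded_linear[OF bounded_linear_divide])

lemma smooth_scaleR [smooth_intros]: "smooth f \<Longrightarrow> smooth g \<Longrightarrow> smooth (\<lambda>p. f p *\<^sub>R g p)"
  by (auto simp: smooth_def C_k_bilinear[OF bounded_bilinear_scaleR])

lemma smooth_mult [smooth_intros]:
  fixes f g :: "_ \<Rightarrow> real"
  shows "smooth f \<Longrightarrow> smooth g \<Longrightarrow> smooth (\<lambda>p. f p * g p)"
  by (auto simp: smooth_def C_k_bilinear[OF bounded_bilinear_mult])

lemma smooth_sum [smooth_intros]:
  "(\<And>i. i \<in> I \<Longrightarrow> smooth (f i)) \<Longrightarrow> smooth (\<lambda>p. \<Sum>i\<in>I. f i p)"
  by (induction I rule: infinite_finite_induct) (auto intro: smooth_intros)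

lemma smooth_imp_differentiable: "smooth f \<Longrightarrow> f differentiable at p"
  using C_k.simps(2)[of 0 f] unfolding smooth_def by blast

lemma smooth_imp_isCont: "smooth f \<Longrightarrow> isCont f p"
  by (intro differentiable_imp_continuous_within smooth_imp_differentiable)

lemma smooth_has_derivative: "smooth f \<Longrightarrow> (f has_derivative frechet_derivative f (at p)) (at p)"
  using smooth_imp_differentiable frechet_derivative_works by blast

lemma smooth_frechet_derivative [smooth_intros]:
  "smooth f \<Longrightarrow> smooth (\<lambda>p. frechet_derivative f (at p) v)"
  using C_k.simps(2) unfolding smooth_def by blast

text \<open>\<open>C_k\<close> tests derivatives in constant directions only. Expanding the
  direction in the basis reduces derivatives along a varying field to these.\<close>

lemma frechet_derivative_Basis_sum:
  fixes f :: "'a::euclidean_space \<Rightarrow> 'b::real_normed_vector"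
  assumes "smooth f"
  shows "frechet_derivative f (at p) v = (\<Sum>b\<in>Basis. (v \<bullet> b) *\<^sub>R frechet_derivative f (at p) b)"
proof -
  interpret linear "frechet_derivative f (at p)"
    using assms by (intro linear_frechet_derivative smooth_imp_differentiable)
  have "frechet_derivative f (at p) (\<Sum>b\<in>Basis. (v \<bullet> b) *\<^sub>R b)
      = (\<Sum>b\<in>Basis. (v \<bullet> b) *\<^sub>R frechet_derivative f (at p) b)"
    by (simp only: sum scale)
  then show ?thesis by (simp only: euclidean_representation)
qed

lemma smooth_dir_deriv [smooth_intros]:
  assumes "smooth X" "smooth f"
  shows "smooth (dir_deriv X f)"
  unfolding dir_deriv_def frechet_derivative_Basis_sum[OF assms(2), of _ "X _"]
  by (intro smooth_intros assms smooth_bounded_linear[OF bounded_linear_inner_left])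

lemma smooth_lie_bracket [smooth_intros]: "smooth X \<Longrightarrow> smooth Y \<Longrightarrow> smooth (lie_bracket X Y)"
  unfolding lie_bracket_def by (intro smooth_intros)

subsection \<open>Symmetry of second derivatives\<close>

text \<open>Two applications of the mean value theorem: first along \<open>b\<close> to a difference
  in direction \<open>c\<close>, then along \<open>c\<close> to the derivative in direction
  \<open>b\<close>.\<close>

lemma second_difference_mean_value:
  fixes f :: "'a::euclidean_space \<Rightarrow> real"
  assumes f: "smooth f" and h: "0 < h"
  obtains s t where "0 < s" "s < h" "0 < t" "t < h"
    "f (p + h *\<^sub>R b + h *\<^sub>R c) - f (p + h *\<^sub>R b) - f (p + h *\<^sub>R c) + f p
     = h * h * frechet_derivative (\<lambda>q. frechet_derivative f (at q) b) (at (p + s *\<^sub>R b + t *\<^sub>R c)) c"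
proof -
  have line: "((\<lambda>s. k (q + s *\<^sub>R d)) has_real_derivative
      frechet_derivative k (at (q + s *\<^sub>R d)) d) (at s)" if "smooth k" for k :: "'a \<Rightarrow> real" and q d s
  proof -
    interpret linear "frechet_derivative k (at (q + s *\<^sub>R d))"
      using that by (intro linear_frechet_derivative smooth_imp_differentiable)
    have "((\<lambda>s. q + s *\<^sub>R d) has_derivative (\<lambda>u. u *\<^sub>R d)) (at s)"
      by (auto intro!: derivative_eq_intros)
    from diff_chain_at[OF this smooth_has_derivative[OF that]] show ?thesis
      unfolding o_def by (rule has_derivative_imp_has_field_derivative) (simp add: scale)
  qed
  \<comment> \<open>Chosen so that \<open>?g h - ?g 0\<close> is the second difference of the
    statement.\<close>
  let ?g = "\<lambda>s. f ((p + h *\<^sub>R c) + s *\<^sub>R b) - f (p + s *\<^sub>R b)"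
  let ?g' = "\<lambda>s. frechet_derivative f (at ((p + h *\<^sub>R c) + s *\<^sub>R b)) b
    - frechet_derivative f (at (p + s *\<^sub>R b)) b"
  obtain s where s: "0 < s" "s < h" and "?g h - ?g 0 = (h - 0) * ?g' s"
    using MVT2[OF h, of ?g ?g', OF DERIV_diff[OF line[OF f] line[OF f]]] by blast
  moreover
  let ?k = "\<lambda>q. frechet_derivative f (at q) b"
  obtain t where t: "0 < t" "t < h" and
    "?k ((p + s *\<^sub>R b) + h *\<^sub>R c) - ?k ((p + s *\<^sub>R b) + 0 *\<^sub>R c)
      = (h - 0) * frechet_derivative ?k (at ((p + s *\<^sub>R b) + t *\<^sub>R c)) c"
    using MVT2[OF h, of "\<lambda>t. ?k ((p + s *\<^sub>R b) + t *\<^sub>R c)"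
        "\<lambda>t. frechet_derivative ?k (at ((p + s *\<^sub>R b) + t *\<^sub>R c)) c"]
      line[OF smooth_frechet_derivative[OF f]] by blast
  ultimately show ?thesis
    by (intro that[OF s t]) (simp add: algebra_simps)
qed

text \<open>Schwarz's theorem: the second difference quotient is symmetric in \<open>b\<close> and
  \<open>c\<close>, and it converges to either mixed derivative.\<close>

lemma frechet_derivative_commute:
  fixes f :: "'a::euclidean_space \<Rightarrow> real"
  assumes f: "smooth f"
  shows "frechet_derivative (\<lambda>q. frechet_derivative f (at q) b) (at p) c
    = frechet_derivative (\<lambda>q. frechet_derivative f (at q) c) (at p) b"
proof -
  have lim: "((\<lambda>h. (f (p + h *\<^sub>R b + h *\<^sub>R c) - f (p + h *\<^sub>R b) - f (p + h *\<^sub>R c) + f p) / (h * h))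
      \<longlongrightarrow> frechet_derivative (\<lambda>q. frechet_derivative f (at q) b) (at p) c) (at_right 0)"
    (is "(?\<Delta> \<longlongrightarrow> ?H p) _") for b c
  proof -
    have "\<exists>s t. 0 < s \<and> s < h \<and> 0 < t \<and> t < h \<and> ?\<Delta> h = ?H (p + s *\<^sub>R b + t *\<^sub>R c)"
      if "0 < h" for h
    proof -
      obtain s t where "0 < s" "s < h" "0 < t" "t < h"
        "f (p + h *\<^sub>R b + h *\<^sub>R c) - f (p + h *\<^sub>R b) - f (p + h *\<^sub>R c) + f p
          = h * h * ?H (p + s *\<^sub>R b + t *\<^sub>R c)"
        using second_difference_mean_value[OF f \<open>0 < h\<close>, of p b c] by blast
      with \<open>0 < h\<close> show ?thesis by auto
    qed
    \<comment> \<open>The mean value points become functions of \<open>h\<close>. Squeezed between 0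
      and \<open>h\<close>, they tend to 0, and continuity of the second derivative then gives the
      limit.\<close>
    then obtain s t where st: "\<And>h. 0 < h \<Longrightarrow> 0 < s h \<and> s h < h \<and> 0 < t h \<and> t h < h \<and>
        ?\<Delta> h = ?H (p + s h *\<^sub>R b + t h *\<^sub>R c)"
      by metis
    have ev: "\<forall>\<^sub>F h in at_right (0::real). 0 < h"
      by (simp add: eventually_at_right_less)
    have s: "(s \<longlongrightarrow> 0) (at_right 0)" and t: "(t \<longlongrightarrow> 0) (at_right 0)"
      by (rule tendsto_sandwich[OF eventually_mono[OF ev] eventually_mono[OF ev] tendsto_const
            tendsto_ident_at]; simp add: st less_imp_le)+
    have "((\<lambda>h. p + s h *\<^sub>R b + t h *\<^sub>R c) \<longlongrightarrow> p + 0 *\<^sub>R b + 0 *\<^sub>R c) (at_right 0)"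
      by (intro tendsto_intros s t)
    then have "((\<lambda>h. p + s h *\<^sub>R b + t h *\<^sub>R c) \<longlongrightarrow> p) (at_right 0)"
      by simp
    then have "((\<lambda>h. ?H (p + s h *\<^sub>R b + t h *\<^sub>R c)) \<longlongrightarrow> ?H p) (at_right 0)"
      by (rule isCont_tendsto_compose[OF smooth_imp_isCont[OF
            smooth_frechet_derivative[OF smooth_frechet_derivative[OF f]]]])
    then show ?thesis
      by (rule Lim_transform_eventually) (rule eventually_mono[OF ev], simp add: st)
  qed
  have "((\<lambda>h. (f (p + h *\<^sub>R b + h *\<^sub>R c) - f (p + h *\<^sub>R b) - f (p + h *\<^sub>R c) + f p) / (h * h))
      \<longlongrightarrow> frechet_derivative (\<lambda>q. frechet_derivative f (at q) c) (at p) b) (at_right 0)"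
    using lim[of c b] by (simp add: algebra_simps)
  with lim[of b c] show ?thesis
    using tendsto_unique trivial_limit_at_right_real by blast
qed

subsection \<open>Directional derivatives\<close>

lemma dir_deriv_const: "dir_deriv X (\<lambda>p. c) p = 0"
  by (simp add: dir_deriv_def)

lemma dir_deriv_bounded_linear:
  "bounded_linear h \<Longrightarrow> smooth f \<Longrightarrow> dir_deriv X (\<lambda>p. h (f p)) p = h (dir_deriv X f p)"
  by (simp add: dir_deriv_def frechet_derivative_bounded_linear smooth_imp_differentiable)

lemma dir_deriv_coordinate: "dir_deriv X (\<lambda>p. p $ i) p = X p $ i"
  by (simp add: dir_deriv_def frechet_derivative_bounded_linear[OF bounded_linear_vec_nth])

lemma dir_deriv_add:
  "smooth f \<Longrightarrow> smooth g \<Longrightarrow> dir_deriv X (\<lambda>p. f p + g p) p = dir_deriv X f p + dir_deriv X g p"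
  by (simp add: dir_deriv_def frechet_derivative_add smooth_imp_differentiable)

lemma dir_deriv_minus: "smooth f \<Longrightarrow> dir_deriv X (\<lambda>p. - f p) p = - dir_deriv X f p"
  by (rule dir_deriv_bounded_linear[OF bounded_linear_minus[OF bounded_linear_ident]])

lemma dir_deriv_diff:
  "smooth f \<Longrightarrow> smooth g \<Longrightarrow> dir_deriv X (\<lambda>p. f p - g p) p = dir_deriv X f p - dir_deriv X g p"
  using dir_deriv_add[OF _ smooth_minus, of f g] by (simp add: dir_deriv_minus)

lemma dir_deriv_mult:
  fixes f g :: "_ \<Rightarrow> real"
  shows "smooth f \<Longrightarrow> smooth g \<Longrightarrow>
    dir_deriv X (\<lambda>p. f p * g p) p = f p * dir_deriv X g p + dir_deriv X f p * g p"
  by (simp add: dir_deriv_def frechet_derivative_bilinear[OF bounded_bilinear_mult]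
      smooth_imp_differentiable)

lemma dir_deriv_divide_const:
  "smooth f \<Longrightarrow> dir_deriv X (\<lambda>p. f p / (c::real)) p = dir_deriv X f p / c"
  by (rule dir_deriv_bounded_linear[OF bounded_linear_divide])

lemma dir_deriv_sum:
  "(\<And>i. i \<in> I \<Longrightarrow> smooth (f i)) \<Longrightarrow>
    dir_deriv X (\<lambda>p. \<Sum>i\<in>I. f i p) p = (\<Sum>i\<in>I. dir_deriv X (f i) p)"
  by (induction I rule: infinite_finite_induct)
     (auto simp: dir_deriv_const dir_deriv_add smooth_sum)

lemma dir_deriv_add_left:
  assumes "smooth f"
  shows "dir_deriv (\<lambda>p. X p + Y p) f p = dir_deriv X f p + dir_deriv Y f p"
  using linear_frechet_derivative[OF smooth_imp_differentiable[OF assms, of p]]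
  by (simp add: dir_deriv_def linear_add)

lemma dir_deriv_scaleR_left:
  assumes "smooth f"
  shows "dir_deriv (\<lambda>p. h p *\<^sub>R X p) f p = h p *\<^sub>R dir_deriv X f p"
  using linear_frechet_derivative[OF smooth_imp_differentiable[OF assms, of p]]
  by (simp add: dir_deriv_def linear_scale)

lemma dir_deriv_Basis_sum:
  "smooth f \<Longrightarrow> dir_deriv X f p = (\<Sum>b\<in>Basis. (X p \<bullet> b) *\<^sub>R frechet_derivative f (at p) b)"
  unfolding dir_deriv_def by (rule frechet_derivative_Basis_sum)

text \<open>By the product rule, \<open>X (Y f)\<close> is a second-order part plus the derivative
  of \<open>f\<close> along \<open>dir_deriv X Y\<close>. Schwarz's theorem makes the second-order
  part symmetric in \<open>X\<close> and \<open>Y\<close>, so only the bracket survives the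
  subtraction.\<close>

lemma dir_deriv_lie_bracket:
  fixes f :: "'a::euclidean_space \<Rightarrow> real"
  assumes f: "smooth f" and X: "smooth X" and Y: "smooth Y"
  shows "dir_deriv (lie_bracket X Y) f p = dir_deriv X (dir_deriv Y f) p - dir_deriv Y (dir_deriv X f) p"
proof -
  let ?d = "\<lambda>b q. frechet_derivative f (at q) b"
  have second: "dir_deriv X (dir_deriv Y f) p
      = (\<Sum>b\<in>Basis. \<Sum>c\<in>Basis. (Y p \<bullet> b) * (X p \<bullet> c) * frechet_derivative (?d b) (at p) c)
        + frechet_derivative f (at p) (dir_deriv X Y p)" if X: "smooth X" and Y: "smooth Y" for X Y
  proof -
    have Yf: "dir_deriv Y f = (\<lambda>q. \<Sum>b\<in>Basis. (Y q \<bullet> b) * ?d b q)"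
      by (rule ext) (simp add: dir_deriv_Basis_sum[OF f])
    have "dir_deriv X (dir_deriv Y f) p
      = (\<Sum>b\<in>Basis. (Y p \<bullet> b) * dir_deriv X (?d b) p + (dir_deriv X Y p \<bullet> b) * ?d b p)"
      unfolding Yf using Y f
      by (simp add: dir_deriv_sum dir_deriv_mult smooth_intros
          smooth_bounded_linear[OF bounded_linear_inner_left]
          dir_deriv_bounded_linear[OF bounded_linear_inner_left])
    also have "\<dots> = (\<Sum>b\<in>Basis. (Y p \<bullet> b) * dir_deriv X (?d b) p)
        + frechet_derivative f (at p) (dir_deriv X Y p)"
      by (simp add: sum.distrib frechet_derivative_Basis_sum[OF f, of p "dir_deriv X Y p"])
    finally show ?thesis
      using f by (simp add: dir_deriv_Basis_sum[of "?d _"] smooth_intros sum_distrib_left mult.assoc)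
  qed
  have "(\<Sum>b\<in>Basis. \<Sum>c\<in>Basis. (Y p \<bullet> b) * (X p \<bullet> c) * frechet_derivative (?d b) (at p) c)
      = (\<Sum>b\<in>Basis. \<Sum>c\<in>Basis. (X p \<bullet> b) * (Y p \<bullet> c) * frechet_derivative (?d b) (at p) c)"
    by (subst sum.swap) (simp add: frechet_derivative_commute[OF f] mult.commute)
  moreover have "frechet_derivative f (at p) (dir_deriv X Y p - dir_deriv Y X p)
      = frechet_derivative f (at p) (dir_deriv X Y p) - frechet_derivative f (at p) (dir_deriv Y X p)"
    using linear_frechet_derivative[OF smooth_imp_differentiable[OF f, of p]] by (rule linear_diff)
  ultimately show ?thesis
    by (simp add: second[OF X Y] second[OF Y X]) (simp add: dir_deriv_def lie_bracket_def)
qed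

subsection \<open>Uniqueness of the Levi-Civita connection\<close>

lemma levi_civita_torsion_free:
  assumes "is_levi_civita g D" "smooth X" "smooth Y"
  shows "D X Y p - D Y X p = lie_bracket X Y p"
  using assms(1)[unfolded is_levi_civita_def, THEN conjunct2, THEN conjunct1,
      rule_format, OF assms(2,3), THEN fun_cong, of p] .

lemma levi_civita_metric:
  assumes "is_levi_civita g D" "smooth X" "smooth Y" "smooth Z"
  shows "dir_deriv X (metric_apply g Y Z) p = g p (D X Y p) (Z p) + g p (Y p) (D X Z p)"
  using assms(1)[unfolded is_levi_civita_def, THEN conjunct2, THEN conjunct2,
      rule_format, OF assms(2,3,4), THEN fun_cong, of p]
  unfolding metric_apply_def .

text \<open>The difference of two such connections, paired with \<open>Z\<close>, is symmetric in
  \<open>X, Y\<close> because both are torsion-free and skew in \<open>Y, Z\<close> because both are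
  metric; such an expression vanishes. Nondegeneracy of \<open>g\<close> enters only when the
  pairing is evaluated on a frame.\<close>

lemma levi_civita_unique:
  assumes D: "is_levi_civita g D" and D': "is_levi_civita g D'"
    and sym: "\<And>u v. g p u v = g p v u"
    and diff: "\<And>u v w. g p (u - v) w = g p u w - g p v w"
    and X: "smooth X" and Y: "smooth Y" and Z: "smooth Z"
  shows "g p (D X Y p - D' X Y p) (Z p) = 0"
proof -
  define t where "t X Y Z = g p (D X Y p - D' X Y p) (Z p)" for X Y Z
  have symm: "t X Y Z = t Y X Z" if "smooth X" "smooth Y" for X Y Z
  proof -
    have "D X Y p - D' X Y p
        = (D X Y p - D Y X p) - (D' X Y p - D' Y X p) + (D Y X p - D' Y X p)"
      by simp
    then have "D X Y p - D' X Y p = D Y X p - D' Y X p"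
      unfolding levi_civita_torsion_free[OF D that] levi_civita_torsion_free[OF D' that] by simp
    then show ?thesis unfolding t_def by (rule arg_cong)
  qed
  have skew: "t X Y Z = - t X Z Y" if "smooth X" "smooth Y" "smooth Z" for X Y Z
    using levi_civita_metric[OF D that, of p] levi_civita_metric[OF D' that, of p]
    unfolding t_def diff sym[of "Y p" "D X Z p"] sym[of "Y p" "D' X Z p"] by linarith
  \<comment> \<open>Alternating the two symmetries gives XYZ = -XZY = -ZXY = ZYX = YZX = -YXZ =
    -XYZ.\<close>
  have "t X Y Z = - t X Y Z"
    using skew[OF X Y Z] symm[OF X Z, of Y] skew[OF Z X Y] symm[OF Z Y, of X] skew[OF Y Z X]
      symm[OF X Y, of Z] by linarith
  then show ?thesis by (simp add: t_def)
qed

subsection \<open>Components in the left-invariant frame\<close>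

text \<open>\<open>coef1\<close>, \<open>coef2\<close> and \<open>coef3\<close> evaluate the dual
  coframe \<open>dy\<close>, \<open>dx / lam\<close>, \<open>x dy + dz\<close> of \<open>e1\<close>,
  \<open>e2\<close>, \<open>e3\<close>.\<close>

definition coef1 :: "heis vector_field \<Rightarrow> heis \<Rightarrow> real" where
  "coef1 X p = X p $ 2"

definition coef2 :: "real \<Rightarrow> heis vector_field \<Rightarrow> heis \<Rightarrow> real" where
  "coef2 lam X p = X p $ 1 / lam"

definition coef3 :: "heis vector_field \<Rightarrow> heis \<Rightarrow> real" where
  "coef3 X p = p $ 1 * X p $ 2 + X p $ 3"

definition frame_field ::
    "real \<Rightarrow> (heis \<Rightarrow> real) \<Rightarrow> (heis \<Rightarrow> real) \<Rightarrow> (heis \<Rightarrow> real) \<Rightarrow> heis vector_field" where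
  "frame_field lam f g h = (\<lambda>p. f p *\<^sub>R e1 p + g p *\<^sub>R e2 lam p + h p *\<^sub>R e3 p)"

lemma coef_e [simp]:
  "coef1 e1 = (\<lambda>p. 1)" "coef2 lam e1 = (\<lambda>p. 0)" "coef3 e1 = (\<lambda>p. 0)"
  "coef1 (e2 lam) = (\<lambda>p. 0)" "coef3 (e2 lam) = (\<lambda>p. 0)"
  "coef1 e3 = (\<lambda>p. 0)" "coef2 lam e3 = (\<lambda>p. 0)" "coef3 e3 = (\<lambda>p. 1)"
  "lam \<noteq> 0 \<Longrightarrow> coef2 lam (e2 lam) = (\<lambda>p. 1)"
  by (auto simp: coef1_def coef2_def coef3_def e1_def e2_def e3_def)

lemma coef_add [simp]:
  "coef1 (\<lambda>p. X p + Y p) = (\<lambda>p. coef1 X p + coef1 Y p)"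
  "coef2 lam (\<lambda>p. X p + Y p) = (\<lambda>p. coef2 lam X p + coef2 lam Y p)"
  "coef3 (\<lambda>p. X p + Y p) = (\<lambda>p. coef3 X p + coef3 Y p)"
  by (auto simp: coef1_def coef2_def coef3_def add_divide_distrib algebra_simps)

lemma coef_diff [simp]:
  "coef1 (\<lambda>p. X p - Y p) = (\<lambda>p. coef1 X p - coef1 Y p)"
  "coef2 lam (\<lambda>p. X p - Y p) = (\<lambda>p. coef2 lam X p - coef2 lam Y p)"
  "coef3 (\<lambda>p. X p - Y p) = (\<lambda>p. coef3 X p - coef3 Y p)"
  by (auto simp: coef1_def coef2_def coef3_def diff_divide_distrib algebra_simps)

lemma coef_scaleR [simp]:
  "coef1 (\<lambda>p. f p *\<^sub>R X p) = (\<lambda>p. f p * coef1 X p)"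
  "coef2 lam (\<lambda>p. f p *\<^sub>R X p) = (\<lambda>p. f p * coef2 lam X p)"
  "coef3 (\<lambda>p. f p *\<^sub>R X p) = (\<lambda>p. f p * coef3 X p)"
  by (auto simp: coef1_def coef2_def coef3_def algebra_simps)

lemma coef_zero [simp]:
  "coef1 (\<lambda>p. 0) = (\<lambda>p. 0)" "coef2 lam (\<lambda>p. 0) = (\<lambda>p. 0)" "coef3 (\<lambda>p. 0) = (\<lambda>p. 0)"
  by (auto simp: coef1_def coef2_def coef3_def)

lemma coef_frame_field [simp]:
  "coef1 (frame_field lam f g h) = f"
  "lam \<noteq> 0 \<Longrightarrow> coef2 lam (frame_field lam f g h) = g"
  "coef3 (frame_field lam f g h) = h"
  by (auto simp: frame_field_def)

lemma vector_field_eqI: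
  assumes "lam \<noteq> 0" "coef1 X = coef1 Y" "coef2 lam X = coef2 lam Y" "coef3 X = coef3 Y"
  shows "X = Y"
proof
  fix p
  show "X p = Y p"
    using assms(1) assms(2-4)[THEN fun_cong, of p]
    by (auto simp: coef1_def coef2_def coef3_def vec_eq_iff forall_3)
qed

lemma frame_field_coef:
  assumes "lam \<noteq> 0"
  shows "frame_field lam (coef1 X) (coef2 lam X) (coef3 X) = X"
  using assms by (intro vector_field_eqI[OF assms]) simp_all

lemma smooth_coef [smooth_intros]:
  assumes "smooth X"
  shows "smooth (coef1 X)" "smooth (coef2 lam X)" "smooth (coef3 X)"
  unfolding coef1_def[abs_def] coef2_def[abs_def] coef3_def[abs_def]
  by (intro smooth_intros assms)+

lemma smooth_e [smooth_intros]: "smooth e1" "smooth (e2 lam)" "smooth e3"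
proof -
  \<comment> \<open>In terms of \<open>axis\<close>, the fields are built by operations that
    preserve smoothness.\<close>
  have e: "e1 = (\<lambda>p. axis 2 1 - p $ 1 *\<^sub>R axis 3 1)" "e2 lam = (\<lambda>p. axis 1 lam)" "e3 = (\<lambda>p. axis 3 1)"
    by (auto simp: e1_def e2_def e3_def vec_eq_iff forall_3 axis_def)
  show "smooth e1" "smooth (e2 lam)" "smooth e3"
    unfolding e by (intro smooth_intros)+
qed

lemma smooth_frame_field [smooth_intros]:
  "smooth f \<Longrightarrow> smooth g \<Longrightarrow> smooth h \<Longrightarrow> smooth (frame_field lam f g h)"
  unfolding frame_field_def by (intro smooth_intros)

lemma dir_deriv_frame:
  fixes f :: "heis \<Rightarrow> real"
  assumes "lam \<noteq> 0" and f: "smooth f"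
  shows "dir_deriv Y f p
    = coef1 Y p * dir_deriv e1 f p + coef2 lam Y p * dir_deriv (e2 lam) f p + coef3 Y p * dir_deriv e3 f p"
proof -
  have "dir_deriv (frame_field lam (coef1 Y) (coef2 lam Y) (coef3 Y)) f p
    = coef1 Y p * dir_deriv e1 f p + coef2 lam Y p * dir_deriv (e2 lam) f p + coef3 Y p * dir_deriv e3 f p"
    unfolding frame_field_def by (simp add: dir_deriv_add_left[OF f] dir_deriv_scaleR_left[OF f])
  then show ?thesis by (simp only: frame_field_coef[OF assms(1)])
qed

text \<open>Only the third coframe element \<open>x dy + dz\<close> has a nonconstant coefficient.
  Its derivative along \<open>X\<close> is \<open>X p $ 1\<close>, that is
  \<open>lam * coef2 lam X p\<close>, which gives the correction term.\<close>

lemma coef_dir_deriv: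
  assumes "smooth Y"
  shows "coef1 (dir_deriv X Y) p = dir_deriv X (coef1 Y) p"
    "coef2 lam (dir_deriv X Y) p = dir_deriv X (coef2 lam Y) p"
    "lam \<noteq> 0 \<Longrightarrow> coef3 (dir_deriv X Y) p = dir_deriv X (coef3 Y) p - lam * (coef2 lam X p * coef1 Y p)"
proof -
  have nth: "dir_deriv X (\<lambda>p. Y p $ i) p = dir_deriv X Y p $ i" for i
    by (rule dir_deriv_bounded_linear[OF bounded_linear_vec_nth assms])
  show "coef1 (dir_deriv X Y) p = dir_deriv X (coef1 Y) p"
    by (simp add: coef1_def[abs_def] nth)
  show "coef2 lam (dir_deriv X Y) p = dir_deriv X (coef2 lam Y) p"
    using dir_deriv_bounded_linear[OF bounded_linear_divide smooth_vec_nth[OF assms]]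
    by (simp add: coef2_def[abs_def] nth)
  show "coef3 (dir_deriv X Y) p = dir_deriv X (coef3 Y) p - lam * (coef2 lam X p * coef1 Y p)"
    if "lam \<noteq> 0"
    using that assms
    by (simp add: coef1_def coef2_def coef3_def[abs_def] dir_deriv_add dir_deriv_mult smooth_intros nth
        dir_deriv_coordinate)
qed

text \<open>The last term of the third component encodes \<open>[e1, e2] = lam e3\<close>; it is the
  antisymmetrised correction from \<open>coef_dir_deriv\<close>.\<close>

lemma coef_lie_bracket:
  assumes "lam \<noteq> 0" "smooth X" "smooth Y"
  shows "coef1 (lie_bracket X Y) = (\<lambda>p. dir_deriv X (coef1 Y) p - dir_deriv Y (coef1 X) p)"
    "coef2 lam (lie_bracket X Y) = (\<lambda>p. dir_deriv X (coef2 lam Y) p - dir_deriv Y (coef2 lam X) p)"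
    "coef3 (lie_bracket X Y) = (\<lambda>p. dir_deriv X (coef3 Y) p - dir_deriv Y (coef3 X) p
      + lam * (coef1 X p * coef2 lam Y p - coef2 lam X p * coef1 Y p))"
  unfolding lie_bracket_def using assms
  by (simp_all add: coef_dir_deriv coef_dir_deriv(3)[where lam = lam] fun_eq_iff algebra_simps)

lemma dir_deriv_frame_commute:
  fixes f :: "heis \<Rightarrow> real"
  assumes lam: "lam \<noteq> 0" and f: "smooth f"
  shows "dir_deriv e1 (dir_deriv (e2 lam) f) p - dir_deriv (e2 lam) (dir_deriv e1 f) p
      = lam * dir_deriv e3 f p"
    and "dir_deriv e1 (dir_deriv e3 f) p = dir_deriv e3 (dir_deriv e1 f) p"
    and "dir_deriv (e2 lam) (dir_deriv e3 f) p = dir_deriv e3 (dir_deriv (e2 lam) f) p"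
  using dir_deriv_lie_bracket[OF f smooth_e(1) smooth_e(2), of lam p]
    dir_deriv_lie_bracket[OF f smooth_e(1) smooth_e(3), of p]
    dir_deriv_lie_bracket[OF f smooth_e(2) smooth_e(3), of lam p]
    dir_deriv_frame[OF lam f, of "lie_bracket e1 (e2 lam)" p]
    dir_deriv_frame[OF lam f, of "lie_bracket e1 e3" p]
    dir_deriv_frame[OF lam f, of "lie_bracket (e2 lam) e3" p]
  by (simp_all add: coef_lie_bracket[OF lam] smooth_intros dir_deriv_const lam)

lemma g2_frame:
  assumes "lam \<noteq> 0"
  shows "metric_apply (g2 lam) Y Z p
    = coef1 Y p * coef1 Z p + coef2 lam Y p * coef2 lam Z p - coef3 Y p * coef3 Z p"
  using assms
  by (simp add: metric_apply_def g2_def coef1_def coef2_def coef3_def power2_eq_square)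

subsection \<open>Levi-Civita connection and curvature of \<open>g\<^sub>2\<close>\<close>

text \<open>What the Koszul formula gives in the frame, writing \<open>D\<close> for the connection:
  \<open>D e1 e2 = lam/2 e3 = - D e2 e1\<close>, \<open>D e1 e3 = D e3 e1 = lam/2 e2\<close>,
  \<open>D e2 e3 = D e3 e2 = - lam/2 e1\<close>.\<close>

definition heis_connection :: "real \<Rightarrow> heis vector_field \<Rightarrow> heis vector_field \<Rightarrow> heis vector_field" where
  "heis_connection lam X Y = frame_field lam
     (\<lambda>p. dir_deriv X (coef1 Y) p - lam / 2 * (coef2 lam X p * coef3 Y p + coef3 X p * coef2 lam Y p))
     (\<lambda>p. dir_deriv X (coef2 lam Y) p + lam / 2 * (coef1 X p * coef3 Y p + coef3 X p * coef1 Y p))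
     (\<lambda>p. dir_deriv X (coef3 Y) p + lam / 2 * (coef1 X p * coef2 lam Y p - coef2 lam X p * coef1 Y p))"

lemma smooth_heis_connection [smooth_intros]:
  "smooth X \<Longrightarrow> smooth Y \<Longrightarrow> smooth (heis_connection lam X Y)"
  unfolding heis_connection_def by (intro smooth_intros)

lemma coef_heis_connection:
  assumes "lam \<noteq> 0"
  shows "coef1 (heis_connection lam X Y) =
      (\<lambda>p. dir_deriv X (coef1 Y) p - lam / 2 * (coef2 lam X p * coef3 Y p + coef3 X p * coef2 lam Y p))"
    "coef2 lam (heis_connection lam X Y) =
      (\<lambda>p. dir_deriv X (coef2 lam Y) p + lam / 2 * (coef1 X p * coef3 Y p + coef3 X p * coef1 Y p))"
    "coef3 (heis_connection lam X Y) =
      (\<lambda>p. dir_deriv X (coef3 Y) p + lam / 2 * (coef1 X p * coef2 lam Y p - coef2 lam X p * coef1 Y p))"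
  using assms by (simp_all add: heis_connection_def)

text \<open>In the torsion, the algebraic terms of the first two components cancel by symmetry,
  while those of the third add up to the bracket term. For fixed \<open>X\<close> the algebraic
  terms are skew with respect to \<open>g2\<close>, which gives metric compatibility.\<close>

lemma heis_connection_is_levi_civita:
  assumes lam: "lam \<noteq> 0"
  shows "is_levi_civita (g2 lam) (heis_connection lam)"
proof -
  note coefs = coef_heis_connection[OF lam] coef_lie_bracket[OF lam]
  let ?D = "heis_connection lam"
  have "affine_connection ?D"
    unfolding affine_connection_def
  proof (intro conjI allI impI)
    fix X X' Y Y' :: "heis vector_field" and f :: "heis \<Rightarrow> real"
    assume X: "smooth X"
    show "smooth (?D X Y)" if "smooth Y"
      using X that by (rule smooth_heis_connection)
    show "?D (\<lambda>p. X p + X' p) Y = (\<lambda>p. ?D X Y p + ?D X' Y p)" if "smooth X'" "smooth Y"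
      using that
      by (intro vector_field_eqI[OF lam])
         (simp_all add: coefs dir_deriv_add_left smooth_intros algebra_simps)
    show "?D X (\<lambda>p. Y p + Y' p) = (\<lambda>p. ?D X Y p + ?D X Y' p)" if "smooth Y" "smooth Y'"
      using that
      by (intro vector_field_eqI[OF lam])
         (simp_all add: coefs dir_deriv_add smooth_intros algebra_simps)
  next
    fix X Y :: "heis vector_field" and f :: "heis \<Rightarrow> real"
    assume f: "smooth f" and X: "smooth X" and Y: "smooth Y"
    show "?D (\<lambda>p. f p *\<^sub>R X p) Y = (\<lambda>p. f p *\<^sub>R ?D X Y p)"
      using Y
      by (intro vector_field_eqI[OF lam])
         (simp_all add: coefs dir_deriv_scaleR_left smooth_intros algebra_simps)
    show "?D X (\<lambda>p. f p *\<^sub>R Y p) = (\<lambda>p. f p *\<^sub>R ?D X Y p + dir_deriv X f p *\<^sub>R Y p)"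
      using f Y
      by (intro vector_field_eqI[OF lam])
         (simp_all add: coefs dir_deriv_mult smooth_intros algebra_simps)
  qed
  moreover have "(\<lambda>p. ?D X Y p - ?D Y X p) = lie_bracket X Y"
    if "smooth X" "smooth Y" for X Y
    using that by (intro vector_field_eqI[OF lam]) (simp_all add: coefs algebra_simps)
  moreover have "dir_deriv X (metric_apply (g2 lam) Y Z) = (\<lambda>p.
      metric_apply (g2 lam) (?D X Y) Z p + metric_apply (g2 lam) Y (?D X Z) p)"
    if "smooth X" "smooth Y" "smooth Z" for X Y Z
    unfolding g2_frame[OF lam, abs_def] using that
    by (intro ext) (simp add: coefs dir_deriv_add dir_deriv_diff dir_deriv_mult smooth_intros algebra_simps)
  ultimately show ?thesis
    unfolding is_levi_civita_def by blast
qed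

text \<open>The explicit connection shows that the choice in \<open>levi_civita\<close> is made from
  a nonempty set. Pairing the difference with \<open>e1\<close>, \<open>e2\<close>,
  \<open>e3\<close> reads off its components up to sign, so uniqueness gives equality.\<close>

lemma levi_civita_g2:
  assumes lam: "lam \<noteq> 0" and X: "smooth X" and Y: "smooth Y"
  shows "levi_civita (g2 lam) X Y = heis_connection lam X Y"
proof -
  let ?A = "\<lambda>p. levi_civita (g2 lam) X Y p - heis_connection lam X Y p"
  have lc: "is_levi_civita (g2 lam) (levi_civita (g2 lam))"
    unfolding levi_civita_def
    by (rule someI[of "is_levi_civita (g2 lam)"]) (rule heis_connection_is_levi_civita[OF lam])
  have "metric_apply (g2 lam) ?A Z p = 0" if "smooth Z" for Z p
    unfolding metric_apply_def
    by (rule levi_civita_unique[OF lc heis_connection_is_levi_civita[OF lam] _ _ X Y that])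
       (simp_all add: g2_def algebra_simps)
  from this[OF smooth_e(1)] this[OF smooth_e(2)[of lam]] this[OF smooth_e(3)] show ?thesis
    by (intro vector_field_eqI[OF lam] ext) (simp_all add: g2_frame[OF lam] lam)
qed

section \<open>The curvature tensor in frame components\<close>

definition heis_curvature ::
    "real \<Rightarrow> heis vector_field \<Rightarrow> heis vector_field \<Rightarrow> heis vector_field \<Rightarrow> heis vector_field" where
  "heis_curvature lam X Y Z = frame_field lam
     (\<lambda>p. lam\<^sup>2 / 4 * (3 * (coef1 X p * coef2 lam Y p - coef2 lam X p * coef1 Y p) * coef2 lam Z p
                   + (coef1 X p * coef3 Y p - coef3 X p * coef1 Y p) * coef3 Z p))
     (\<lambda>p. lam\<^sup>2 / 4 * (- 3 * (coef1 X p * coef2 lam Y p - coef2 lam X p * coef1 Y p) * coef1 Z p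
                   + (coef2 lam X p * coef3 Y p - coef3 X p * coef2 lam Y p) * coef3 Z p))
     (\<lambda>p. lam\<^sup>2 / 4 * ((coef1 X p * coef3 Y p - coef3 X p * coef1 Y p) * coef1 Z p
                   + (coef2 lam X p * coef3 Y p - coef3 X p * coef2 lam Y p) * coef2 lam Z p))"

lemma smooth_heis_curvature [smooth_intros]:
  "smooth X \<Longrightarrow> smooth Y \<Longrightarrow> smooth Z \<Longrightarrow> smooth (heis_curvature lam X Y Z)"
  unfolding heis_curvature_def by (intro smooth_intros)

lemma coef_heis_curvature:
  assumes "lam \<noteq> 0"
  shows "coef1 (heis_curvature lam X Y Z) =
     (\<lambda>p. lam\<^sup>2 / 4 * (3 * (coef1 X p * coef2 lam Y p - coef2 lam X p * coef1 Y p) * coef2 lam Z p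
                   + (coef1 X p * coef3 Y p - coef3 X p * coef1 Y p) * coef3 Z p))"
    "coef2 lam (heis_curvature lam X Y Z) =
     (\<lambda>p. lam\<^sup>2 / 4 * (- 3 * (coef1 X p * coef2 lam Y p - coef2 lam X p * coef1 Y p) * coef1 Z p
                   + (coef2 lam X p * coef3 Y p - coef3 X p * coef2 lam Y p) * coef3 Z p))"
    "coef3 (heis_curvature lam X Y Z) =
     (\<lambda>p. lam\<^sup>2 / 4 * ((coef1 X p * coef3 Y p - coef3 X p * coef1 Y p) * coef1 Z p
                   + (coef2 lam X p * coef3 Y p - coef3 X p * coef2 lam Y p) * coef2 lam Z p))"
  using assms by (simp_all add: heis_curvature_def)

text \<open>All derivatives of the components cancel, those of second order by
  \<open>dir_deriv_lie_bracket\<close>. What remains is algebraic in the components, with the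
  bracketed differences being those of the bivector of \<open>X\<close> and
  \<open>Y\<close>.\<close>

lemma curvature_g2:
  assumes lam: "lam \<noteq> 0" and "smooth X" "smooth Y" "smooth Z"
  shows "curvature (g2 lam) X Y Z = heis_curvature lam X Y Z"
proof -
  have "curvature (g2 lam) X Y Z = (\<lambda>p. heis_connection lam X (heis_connection lam Y Z) p
      - heis_connection lam Y (heis_connection lam X Z) p - heis_connection lam (lie_bracket X Y) Z p)"
    using assms by (simp add: curvature_def Let_def levi_civita_g2 smooth_intros)
  then show ?thesis
    using assms
    by (intro vector_field_eqI[OF lam] ext; simp add: coef_heis_connection coef_heis_curvature
        coef_lie_bracket[OF lam] dir_deriv_lie_bracket dir_deriv_add dir_deriv_diff dir_deriv_mult
        dir_deriv_divide_const dir_deriv_const smooth_intros; simp add: field_simps power2_eq_square)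
qed

text \<open>Covers both the metric, with coefficients 1 and -1, and the Ricci tensor, with equal
  coefficients, so that one computation of the Lie derivative serves both.\<close>

definition diag_form ::
    "real \<Rightarrow> real \<Rightarrow> real \<Rightarrow> heis vector_field \<Rightarrow> heis vector_field \<Rightarrow> heis \<Rightarrow> real" where
  "diag_form lam \<alpha> \<beta> Y Z = (\<lambda>p. \<alpha> * (coef1 Y p * coef1 Z p + coef2 lam Y p * coef2 lam Z p)
     + \<beta> * (coef3 Y p * coef3 Z p))"

lemma metric_apply_g2:
  assumes "lam \<noteq> 0"
  shows "metric_apply (g2 lam) = diag_form lam 1 (- 1)"
  by (intro ext) (simp add: g2_frame[OF assms] diag_form_def)

lemma ricci_g2:
  assumes lam: "lam \<noteq> 0" and Y: "smooth Y" and Z: "smooth Z"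
  shows "ricci (g2 lam) (heis_frame lam) Y Z = diag_form lam (lam\<^sup>2 / 2) (lam\<^sup>2 / 2) Y Z"
proof
  fix p
  \<comment> \<open>The minus sign is \<open>g(e3, e3) = -1\<close>.\<close>
  have "ricci (g2 lam) (heis_frame lam) Y Z p
      = metric_apply (g2 lam) (heis_curvature lam e1 Y Z) e1 p
      + metric_apply (g2 lam) (heis_curvature lam (e2 lam) Y Z) (e2 lam) p
      - metric_apply (g2 lam) (heis_curvature lam e3 Y Z) e3 p"
    using assms by (simp add: ricci_def sum_3 heis_frame_def curvature_g2 smooth_intros g2_frame)
  also have "\<dots> = diag_form lam (lam\<^sup>2 / 2) (lam\<^sup>2 / 2) Y Z p"
    using lam by (simp add: g2_frame coef_heis_curvature diag_form_def field_simps)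
  finally show "ricci (g2 lam) (heis_frame lam) Y Z p
      = diag_form lam (lam\<^sup>2 / 2) (lam\<^sup>2 / 2) Y Z p" .
qed

subsection \<open>Infinitesimal symmetries in frame components\<close>

text \<open>The derivatives along \<open>X\<close> of the components of \<open>Y\<close> and
  \<open>Z\<close> cancel against those in the brackets, leaving only derivatives of the components
  of \<open>X\<close>.\<close>

lemma lie_deriv_diag_form:
  assumes lam: "lam \<noteq> 0" and "smooth X" "smooth Y" "smooth Z"
  shows "lie_deriv_02 X (diag_form lam \<alpha> \<beta>) Y Z p =
    \<alpha> * (dir_deriv Y (coef1 X) p * coef1 Z p + coef1 Y p * dir_deriv Z (coef1 X) p
        + dir_deriv Y (coef2 lam X) p * coef2 lam Z p + coef2 lam Y p * dir_deriv Z (coef2 lam X) p)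
    + \<beta> * ((dir_deriv Y (coef3 X) p - lam * (coef1 X p * coef2 lam Y p - coef2 lam X p * coef1 Y p)) * coef3 Z p
        + coef3 Y p * (dir_deriv Z (coef3 X) p - lam * (coef1 X p * coef2 lam Z p - coef2 lam X p * coef1 Z p)))"
  using assms(2-4)
  by (simp add: lie_deriv_02_def diag_form_def coef_lie_bracket[OF lam] dir_deriv_add dir_deriv_mult
      dir_deriv_const smooth_intros algebra_simps)

text \<open>The Lie derivative evaluated on the frame pairs 11, 22, 33, 12, 13, 23, with nonzero
  constant factors removed. The coefficients survive only in the last two equations, next to
  derivatives along \<open>e3\<close>.\<close>

definition diag_killing_eqs :: "real \<Rightarrow> real \<Rightarrow> real \<Rightarrow> heis vector_field \<Rightarrow> bool" where
  "diag_killing_eqs lam \<alpha> \<beta> X \<longleftrightarrow> (\<forall>p.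
     dir_deriv e1 (coef1 X) p = 0 \<and>
     dir_deriv (e2 lam) (coef2 lam X) p = 0 \<and>
     dir_deriv e3 (coef3 X) p = 0 \<and>
     dir_deriv e1 (coef2 lam X) p + dir_deriv (e2 lam) (coef1 X) p = 0 \<and>
     \<alpha> * dir_deriv e3 (coef1 X) p + \<beta> * (dir_deriv e1 (coef3 X) p + lam * coef2 lam X p) = 0 \<and>
     \<alpha> * dir_deriv e3 (coef2 lam X) p + \<beta> * (dir_deriv (e2 lam) (coef3 X) p - lam * coef1 X p) = 0)"

lemma lie_deriv_diag_form_eq_0_iff:
  assumes lam: "lam \<noteq> 0" and "\<alpha> \<noteq> 0" "\<beta> \<noteq> 0" and X: "smooth X"
  shows "(\<forall>Y Z. smooth Y \<longrightarrow> smooth Z \<longrightarrow> lie_deriv_02 X (diag_form lam \<alpha> \<beta>) Y Z = (\<lambda>p. 0))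
    \<longleftrightarrow> diag_killing_eqs lam \<alpha> \<beta> X"
proof
  assume "\<forall>Y Z. smooth Y \<longrightarrow> smooth Z \<longrightarrow> lie_deriv_02 X (diag_form lam \<alpha> \<beta>) Y Z = (\<lambda>p. 0)"
  then have L: "lie_deriv_02 X (diag_form lam \<alpha> \<beta>) Y Z p = 0" if "smooth Y" "smooth Z" for Y Z p
    using that by simp
  note s = smooth_e(1) smooth_e(2)[of lam] smooth_e(3)
  show "diag_killing_eqs lam \<alpha> \<beta> X"
    unfolding diag_killing_eqs_def
    using L[OF s(1) s(1)] L[OF s(2) s(2)] L[OF s(3) s(3)] L[OF s(1) s(2)] L[OF s(1) s(3)]
      L[OF s(2) s(3)] assms
    by (simp add: lie_deriv_diag_form s add.commute)
next
  assume K: "diag_killing_eqs lam \<alpha> \<beta> X"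
  show "\<forall>Y Z. smooth Y \<longrightarrow> smooth Z \<longrightarrow> lie_deriv_02 X (diag_form lam \<alpha> \<beta>) Y Z = (\<lambda>p. 0)"
  proof (intro allI impI ext)
    fix Y Z :: "heis vector_field" and p :: heis
    assume Y: "smooth Y" and Z: "smooth Z"
    let ?D = "\<lambda>E f. dir_deriv E f p"
    let ?y1 = "coef1 Y p" and ?y2 = "coef2 lam Y p" and ?y3 = "coef3 Y p"
    let ?z1 = "coef1 Z p" and ?z2 = "coef2 lam Z p" and ?z3 = "coef3 Z p"
    \<comment> \<open>By bilinearity, the Lie derivative is a combination of the six left-hand
      sides.\<close>
    have "lie_deriv_02 X (diag_form lam \<alpha> \<beta>) Y Z p =
        2 * \<alpha> * ?y1 * ?z1 * ?D e1 (coef1 X) + 2 * \<alpha> * ?y2 * ?z2 * ?D (e2 lam) (coef2 lam X)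
      + 2 * \<beta> * ?y3 * ?z3 * ?D e3 (coef3 X)
      + \<alpha> * (?y1 * ?z2 + ?y2 * ?z1) * (?D e1 (coef2 lam X) + ?D (e2 lam) (coef1 X))
      + (?y1 * ?z3 + ?y3 * ?z1)
        * (\<alpha> * ?D e3 (coef1 X) + \<beta> * (?D e1 (coef3 X) + lam * coef2 lam X p))
      + (?y2 * ?z3 + ?y3 * ?z2)
        * (\<alpha> * ?D e3 (coef2 lam X) + \<beta> * (?D (e2 lam) (coef3 X) - lam * coef1 X p))"
      unfolding lie_deriv_diag_form[OF lam X Y Z]
        dir_deriv_frame[OF lam smooth_coef(1)[OF X], of Y] dir_deriv_frame[OF lam smooth_coef(1)[OF X], of Z]
        dir_deriv_frame[OF lam smooth_coef(2)[OF X, of lam], of Y] dir_deriv_frame[OF lam smooth_coef(2)[OF X], of Z]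
        dir_deriv_frame[OF lam smooth_coef(3)[OF X], of Y] dir_deriv_frame[OF lam smooth_coef(3)[OF X], of Z]
      by (simp add: algebra_simps)
    also have "\<dots> = 0"
      using K[unfolded diag_killing_eqs_def, rule_format, of p] by simp
    finally show "lie_deriv_02 X (diag_form lam \<alpha> \<beta>) Y Z p = 0" .
  qed
qed

section \<open>Killing fields and Ricci collineations as solutions of the six equations\<close>

lemma killing_field_g2_iff:
  assumes "lam \<noteq> 0" "smooth X"
  shows "killing_field (g2 lam) X \<longleftrightarrow> diag_killing_eqs lam 1 (- 1) X"
  using lie_deriv_diag_form_eq_0_iff[OF assms(1) _ _ assms(2), of 1 "- 1"] assms
  by (simp add: killing_field_def metric_apply_g2)

text \<open>\<open>ricci_g2\<close> concerns smooth arguments; it applies inside the Lie derivative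
  because brackets of smooth fields are smooth.\<close>

lemma lie_deriv_ricci_g2:
  assumes "lam \<noteq> 0" "smooth X" "smooth Y" "smooth Z"
  shows "lie_deriv_02 X (ricci (g2 lam) (heis_frame lam)) Y Z
    = lie_deriv_02 X (diag_form lam (lam\<^sup>2 / 2) (lam\<^sup>2 / 2)) Y Z"
  using assms by (simp add: lie_deriv_02_def ricci_g2 smooth_intros)

lemma ricci_collineation_g2_iff:
  assumes "lam \<noteq> 0" "smooth X"
  shows "ricci_collineation (g2 lam) (heis_frame lam) X
    \<longleftrightarrow> diag_killing_eqs lam (lam\<^sup>2 / 2) (lam\<^sup>2 / 2) X"
  using lie_deriv_diag_form_eq_0_iff[OF assms(1) _ _ assms(2), of "lam\<^sup>2 / 2" "lam\<^sup>2 / 2"] assms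
  by (simp add: ricci_collineation_def lie_deriv_ricci_g2)

subsection \<open>Rigidity of Ricci collineations\<close>

text \<open>Compatibility conditions of an overdetermined system: the frame commutators, applied to
  the components of \<open>X\<close>, force both derivatives along \<open>e3\<close> first to be
  constant and then to vanish.\<close>

lemma diag_killing_eqs_rigid:
  assumes lam: "lam \<noteq> 0" and \<alpha>: "\<alpha> \<noteq> 0" and X: "smooth X" and K: "diag_killing_eqs lam \<alpha> \<alpha> X"
  shows "dir_deriv e3 (coef1 X) p = 0" "dir_deriv e3 (coef2 lam X) p = 0"
proof -
  define f1 where "f1 = coef1 X"
  define f2 where "f2 = coef2 lam X"
  define f3 where "f3 = coef3 X"
  define a where "a = dir_deriv e3 f1"
  define b where "b = dir_deriv e3 f2"
  note sf [smooth_intros] = smooth_coef(1)[OF X, folded f1_def] smooth_coef(2)[OF X, of lam, folded f2_def]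
    smooth_coef(3)[OF X, folded f3_def]
  have sa [smooth_intros]: "smooth a" "smooth b"
    unfolding a_def b_def by (intro smooth_intros)+
  note KK = K[unfolded diag_killing_eqs_def, folded f1_def f2_def f3_def, rule_format]
  have K1: "dir_deriv e1 f1 = (\<lambda>p. 0)" and K2: "dir_deriv (e2 lam) f2 = (\<lambda>p. 0)"
    and K3: "dir_deriv e3 f3 = (\<lambda>p. 0)"
    and K12: "(\<lambda>p. dir_deriv e1 f2 p + dir_deriv (e2 lam) f1 p) = (\<lambda>p. 0)"
    using KK by auto
  have K13: "dir_deriv e1 f3 = (\<lambda>p. - (lam * f2 p) - a p)"
  proof
    fix p
    have "\<alpha> * (a p + (dir_deriv e1 f3 p + lam * f2 p)) = 0"
      using KK[of p] by (simp add: a_def distrib_left)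
    with \<alpha> show "dir_deriv e1 f3 p = - (lam * f2 p) - a p" by auto
  qed
  have K23: "dir_deriv (e2 lam) f3 = (\<lambda>p. lam * f1 p - b p)"
  proof
    fix p
    have "\<alpha> * (b p + (dir_deriv (e2 lam) f3 p - lam * f1 p)) = 0"
      using KK[of p] by (simp add: b_def distrib_left)
    with \<alpha> show "dir_deriv (e2 lam) f3 p = lam * f1 p - b p" by auto
  qed
  note comm = dir_deriv_frame_commute[OF lam]
  note calc = dir_deriv_add dir_deriv_minus dir_deriv_diff dir_deriv_mult dir_deriv_const smooth_intros
  \<comment> \<open>Since \<open>e3\<close> commutes with \<open>e1\<close> and \<open>e2\<close>,
    the equations for \<open>f1\<close> and \<open>f2\<close> may be differentiated along
    \<open>e3\<close>.\<close>
  have a1: "dir_deriv e1 a = (\<lambda>p. 0)"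
    using comm(2)[OF sf(1)] by (intro ext) (simp add: a_def K1 dir_deriv_const)
  have b2: "dir_deriv (e2 lam) b = (\<lambda>p. 0)"
    using comm(3)[OF sf(2)] by (intro ext) (simp add: b_def K2 dir_deriv_const)
  have sum: "dir_deriv e1 b p + dir_deriv (e2 lam) a p = 0" for p
  proof -
    have "dir_deriv e3 (\<lambda>p. dir_deriv e1 f2 p + dir_deriv (e2 lam) f1 p) p = 0"
      unfolding K12 by (simp add: dir_deriv_const)
    then show ?thesis
      by (simp add: calc a_def b_def comm(2,3)[OF sf(1)] comm(2,3)[OF sf(2)])
  qed
  \<comment> \<open>The relation \<open>[e1, e2] f3 = lam * e3 f3 = 0\<close>, with the derivatives
    of \<open>f3\<close> substituted. Together with \<open>sum\<close> it makes both terms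
    vanish.\<close>
  have diff: "dir_deriv (e2 lam) a p - dir_deriv e1 b p = 0" for p
    using comm(1)[OF sf(3), of p] by (simp add: K3 K13 K23 calc K1 K2)
  have a2: "dir_deriv (e2 lam) a = (\<lambda>p. 0)" and b1: "dir_deriv e1 b = (\<lambda>p. 0)"
    using sum diff by (auto simp: fun_eq_iff)
  \<comment> \<open>As \<open>lam e3\<close> is the bracket of \<open>e1\<close> and
    \<open>e2\<close>, functions constant along these two are constant along
    \<open>e3\<close>.\<close>
  have a3: "dir_deriv e3 a p = 0" and b3: "dir_deriv e3 b p = 0"
    using comm(1)[OF sa(1), of p] comm(1)[OF sa(2), of p] lam
    by (simp_all add: a1 a2 b1 b2 dir_deriv_const)
  \<comment> \<open>Differentiating the formulas for \<open>e1 f3\<close> and \<open>e2 f3\<close>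
    along \<open>e3\<close>, where \<open>e3 f3 = 0\<close>, isolates \<open>b\<close> and
    \<open>a\<close>.\<close>
  have "- (lam * b p) - dir_deriv e3 a p = 0"
    using comm(2)[OF sf(3), of p] by (simp add: K3 K13 calc b_def)
  moreover have "lam * a p - dir_deriv e3 b p = 0"
    using comm(3)[OF sf(3), of p] by (simp add: K3 K23 calc a_def)
  ultimately show "dir_deriv e3 (coef1 X) p = 0" "dir_deriv e3 (coef2 lam X) p = 0"
    using a3 b3 lam by (simp_all add: a_def b_def f1_def f2_def)
qed

subsection \<open>Curvature collineations\<close>

lemma lie_deriv_curvature_g2:
  assumes "lam \<noteq> 0" "smooth X" "smooth Y" "smooth Z" "smooth W"
  shows "lie_deriv_13 X (curvature (g2 lam)) Y Z W = lie_deriv_13 X (heis_curvature lam) Y Z W"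
  using assms by (simp add: lie_deriv_13_def curvature_g2 smooth_intros)

lemma coef_lie_deriv_13:
  "coef1 (lie_deriv_13 X T Y Z W) p = coef1 (lie_bracket X (T Y Z W)) p
     - coef1 (T (lie_bracket X Y) Z W) p - coef1 (T Y (lie_bracket X Z) W) p - coef1 (T Y Z (lie_bracket X W)) p"
  "coef2 lam (lie_deriv_13 X T Y Z W) p = coef2 lam (lie_bracket X (T Y Z W)) p
     - coef2 lam (T (lie_bracket X Y) Z W) p - coef2 lam (T Y (lie_bracket X Z) W) p
     - coef2 lam (T Y Z (lie_bracket X W)) p"
  "coef3 (lie_deriv_13 X T Y Z W) p = coef3 (lie_bracket X (T Y Z W)) p
     - coef3 (T (lie_bracket X Y) Z W) p - coef3 (T Y (lie_bracket X Z) W) p - coef3 (T Y Z (lie_bracket X W)) p"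
  by (simp_all add: lie_deriv_13_def)

text \<open>The Ricci tensor is the trace of \<open>R(V, Y) Z\<close> in \<open>V\<close>, taken
  with frame and dual coframe, so the metric signs cancel. The terms from the brackets of
  \<open>X\<close> with the frame drop out of the trace.\<close>

lemma lie_deriv_ricci_eq_trace:
  assumes lam: "lam \<noteq> 0" and X: "smooth X" and Y: "smooth Y" and Z: "smooth Z"
  shows "lie_deriv_02 X (diag_form lam (lam\<^sup>2 / 2) (lam\<^sup>2 / 2)) Y Z p =
    coef1 (lie_deriv_13 X (heis_curvature lam) e1 Y Z) p
    + coef2 lam (lie_deriv_13 X (heis_curvature lam) (e2 lam) Y Z) p
    + coef3 (lie_deriv_13 X (heis_curvature lam) e3 Y Z) p"
proof -
  \<comment> \<open>Reduces both sides to polynomials in the nine frame derivatives of the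
    components of \<open>X\<close>, apart from derivatives of \<open>Y\<close> and \<open>Z\<close>,
    which cancel.\<close>
  have fr: "dir_deriv V (coef1 X) p = coef1 V p * dir_deriv e1 (coef1 X) p
      + coef2 lam V p * dir_deriv (e2 lam) (coef1 X) p + coef3 V p * dir_deriv e3 (coef1 X) p"
    "dir_deriv V (coef2 lam X) p = coef1 V p * dir_deriv e1 (coef2 lam X) p
      + coef2 lam V p * dir_deriv (e2 lam) (coef2 lam X) p + coef3 V p * dir_deriv e3 (coef2 lam X) p"
    "dir_deriv V (coef3 X) p = coef1 V p * dir_deriv e1 (coef3 X) p
      + coef2 lam V p * dir_deriv (e2 lam) (coef3 X) p + coef3 V p * dir_deriv e3 (coef3 X) p" for V
    using X by (simp_all add: dir_deriv_frame[OF lam, of _ V] smooth_intros)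
  show ?thesis
    unfolding lie_deriv_diag_form[OF lam X Y Z] coef_lie_deriv_13
    using X Y Z
    by (simp add: lam coef_lie_bracket[OF lam] smooth_intros fr[of Y] fr[of Z]
        fr[of "heis_curvature lam _ _ _"] coef_heis_curvature[OF lam] dir_deriv_add dir_deriv_diff
        dir_deriv_minus dir_deriv_mult dir_deriv_divide_const dir_deriv_const)
       (simp add: field_simps)
qed

text \<open>The hypotheses give \<open>[X, e1] = - w e2\<close>, \<open>[X, e2] = w e1\<close>,
  \<open>[X, e3] = 0\<close>. The curvature formula is invariant under rotations of the plane of
  \<open>e1, e2\<close>.\<close>

lemma lie_deriv_curvature_eq_0:
  assumes lam: "lam \<noteq> 0" and X: "smooth X" and Y: "smooth Y" and Z: "smooth Z" and W: "smooth W"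
    and K: "diag_killing_eqs lam 1 (- 1) X"
    and rot: "\<And>p. dir_deriv e3 (coef1 X) p = 0" "\<And>p. dir_deriv e3 (coef2 lam X) p = 0"
  shows "lie_deriv_13 X (heis_curvature lam) Y Z W = (\<lambda>p. 0)"
proof -
  \<comment> \<open>The infinitesimal rotation angle. It may vary from point to point: the
    invariance is pointwise and no derivative of \<open>w\<close> enters.\<close>
  define w where "w = dir_deriv e1 (coef2 lam X)"
  note KK = K[unfolded diag_killing_eqs_def, rule_format]
  have D1: "dir_deriv V (coef1 X) p = - (w p * coef2 lam V p)" for V p
  proof -
    have "dir_deriv (e2 lam) (coef1 X) p = - w p"
      using KK[of p] unfolding w_def by linarith
    then show ?thesis
      using KK[of p] rot[of p] dir_deriv_frame[OF lam smooth_coef(1)[OF X], of V p] by simp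
  qed
  have D2: "dir_deriv V (coef2 lam X) p = w p * coef1 V p" for V p
    using KK[of p] rot[of p] dir_deriv_frame[OF lam smooth_coef(2)[OF X, of lam], of V p] unfolding w_def
    by simp
  \<comment> \<open>Exactly the term that cancels the algebraic part of the third component of the
    bracket.\<close>
  have D3: "dir_deriv V (coef3 X) p = lam * (coef1 X p * coef2 lam V p - coef2 lam X p * coef1 V p)"
    for V p
  proof -
    have "dir_deriv e1 (coef3 X) p = - (lam * coef2 lam X p)" "dir_deriv (e2 lam) (coef3 X) p = lam * coef1 X p"
      "dir_deriv e3 (coef3 X) p = 0"
      using KK[of p] rot[of p] by auto
    then show ?thesis
      using dir_deriv_frame[OF lam smooth_coef(3)[OF X], of V p] by (simp add: algebra_simps)
  qed
  show ?thesis
    using Y Z W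
    by (intro vector_field_eqI[OF lam] ext; unfold coef_lie_deriv_13;
        simp add: coef_lie_bracket[OF lam] smooth_intros D1 D2 D3
          coef_heis_curvature[OF lam] dir_deriv_add dir_deriv_diff dir_deriv_minus dir_deriv_mult
          dir_deriv_divide_const dir_deriv_const X; simp add: algebra_simps)
qed

text \<open>By rigidity the derivatives along \<open>e3\<close> vanish, so the last two equations
  become a nonzero constant times a factor free of coefficients.\<close>

lemma diag_killing_eqs_change_coefficients:
  assumes "lam \<noteq> 0" "\<alpha> \<noteq> 0" "smooth X" "diag_killing_eqs lam \<alpha> \<alpha> X"
  shows "diag_killing_eqs lam 1 (- 1) X"
  using assms(4) diag_killing_eqs_rigid[OF assms] assms(2) by (simp add: diag_killing_eqs_def)

lemma ricci_collineation_iff_curvature_collineation: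
  assumes lam: "lam \<noteq> 0" and X: "smooth X"
  shows "ricci_collineation (g2 lam) (heis_frame lam) X \<longleftrightarrow> curvature_collineation (g2 lam) X"
proof
  assume "ricci_collineation (g2 lam) (heis_frame lam) X"
  then have K: "diag_killing_eqs lam (lam\<^sup>2 / 2) (lam\<^sup>2 / 2) X"
    by (simp add: ricci_collineation_g2_iff[OF lam X])
  have c: "lam\<^sup>2 / 2 \<noteq> 0" using lam by simp
  show "curvature_collineation (g2 lam) X"
    unfolding curvature_collineation_def
    using lie_deriv_curvature_eq_0[OF lam X _ _ _ diag_killing_eqs_change_coefficients[OF lam c X K]
        diag_killing_eqs_rigid[OF lam c X K]] lam X
    by (simp add: lie_deriv_curvature_g2)
next
  assume "curvature_collineation (g2 lam) X"
  then have L: "lie_deriv_13 X (heis_curvature lam) Y Z W = (\<lambda>p. 0)"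
    if "smooth Y" "smooth Z" "smooth W" for Y Z W
    using that lam X lie_deriv_curvature_g2[OF lam X that] unfolding curvature_collineation_def by metis
  \<comment> \<open>The Lie derivative of the Ricci tensor is a sum of components of vanishing Lie
    derivatives of the curvature.\<close>
  then show "ricci_collineation (g2 lam) (heis_frame lam) X"
    unfolding ricci_collineation_def using lam X
    by (auto simp: lie_deriv_ricci_g2 lie_deriv_ricci_eq_trace L smooth_intros intro!: ext)
qed

section \<open>The explicit Killing fields and the equivalence of collineations\<close>

theorem mainTheorem16:
  fixes lam :: real
  assumes "lam \<noteq> 0"
  shows
    "(\<forall>(c1::real) (c2::real) (c3::real) (c4::real) (f1::heis \<Rightarrow> real) (f2::heis \<Rightarrow> real)
        (f3::heis \<Rightarrow> real) (X::heis vector_field).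
        (\<forall>p. f1 p = - (c1 / lam) * p $ 1 + c2) \<longrightarrow>
        (\<forall>p. f2 p = c1 * p $ 2 + c3) \<longrightarrow>
        (\<forall>p. f3 p = - (c1 / (2 * lam)) * (p $ 1)\<^sup>2 - (lam * c1 / 2) * (p $ 2)\<^sup>2
                     + c2 * p $ 1 - lam * c3 * p $ 2 + c4) \<longrightarrow>
        (\<forall>p. X p = f1 p *\<^sub>R e1 p + f2 p *\<^sub>R e2 lam p + f3 p *\<^sub>R e3 p) \<longrightarrow>
        killing_field (g2 lam) X) \<and>
     (\<forall>X::heis vector_field. smooth X \<longrightarrow>
        (ricci_collineation (g2 lam) (heis_frame lam) X \<longleftrightarrow> curvature_collineation (g2 lam) X))"
proof (intro conjI allI impI)
  fix c1 c2 c3 c4 :: real and f1 f2 f3 :: "heis \<Rightarrow> real" and X :: "heis vector_field"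
  assume f1: "\<forall>p. f1 p = - (c1 / lam) * p $ 1 + c2" and f2: "\<forall>p. f2 p = c1 * p $ 2 + c3"
    and f3: "\<forall>p. f3 p = - (c1 / (2 * lam)) * (p $ 1)\<^sup>2 - (lam * c1 / 2) * (p $ 2)\<^sup>2
                     + c2 * p $ 1 - lam * c3 * p $ 2 + c4"
    and X: "\<forall>p. X p = f1 p *\<^sub>R e1 p + f2 p *\<^sub>R e2 lam p + f3 p *\<^sub>R e3 p"
  \<comment> \<open>Squares are written as products, to which the product rule applies.\<close>
  have f: "f1 = (\<lambda>p. - (c1 / lam) * p $ 1 + c2)" "f2 = (\<lambda>p. c1 * p $ 2 + c3)"
    "f3 = (\<lambda>p. - (c1 / (2 * lam)) * (p $ 1 * p $ 1) - (lam * c1 / 2) * (p $ 2 * p $ 2)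
                     + c2 * p $ 1 - lam * c3 * p $ 2 + c4)"
    using f1 f2 f3 by (auto simp: power2_eq_square)
  have X: "X = frame_field lam f1 f2 f3"
    using X by (auto simp: frame_field_def)
  have "smooth f1" "smooth f2" "smooth f3"
    unfolding f by (intro smooth_intros)+
  then have "smooth X"
    unfolding X by (rule smooth_frame_field)
  have d1: "dir_deriv V f1 p = - (c1 / lam) * V p $ 1" and d2: "dir_deriv V f2 p = c1 * V p $ 2"
    and d3: "dir_deriv V f3 p = - (c1 / lam) * (p $ 1 * V p $ 1) - lam * c1 * (p $ 2 * V p $ 2)
                     + c2 * V p $ 1 - lam * c3 * V p $ 2" for V p
    unfolding f
    by (simp_all only: dir_deriv_add dir_deriv_diff dir_deriv_mult dir_deriv_const
        dir_deriv_coordinate smooth_intros) (simp_all add: field_simps)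
  \<comment> \<open>Here \<open>e1 f2 = c1\<close> and \<open>e2 f1 = - c1\<close> cancel. Nothing
    depends on \<open>z\<close>, so what remains is \<open>e1 f3 = - lam * f2\<close> and
    \<open>e2 f3 = lam * f1\<close>, which \<open>f3\<close> satisfies.\<close>
  have "diag_killing_eqs lam 1 (- 1) X"
    using assms unfolding X diag_killing_eqs_def
    by (simp add: d1 d2 d3 e1_def e2_def e3_def) (simp add: f field_simps)
  then show "killing_field (g2 lam) X"
    using killing_field_g2_iff[OF assms \<open>smooth X\<close>] by simp
qed (rule ricci_collineation_iff_curvature_collineation[OF assms])

end
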